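(* For every fixed integer $r\ge 1$, as $n\to\infty$, $$N(n,r)\le \left(\frac r2+o(1)\right)\log n\cdot M(n,r).$$ That is, for every integer $r\ge 1$ and every $\varepsilon>0$ there is $n_0$ such that $N(n,r)\le \left(\frac r2+\varepsilon\right)\log n\cdot M(n,r)$ for all $n\ge n_0$.
   Context: $B_n=2^{[n]}$ is the Boolean lattice of all subsets of $[n]=\{1,\dots,n\}$ ordered by inclusion. A chain is a set of pairwise comparable elements; a chain $C$ covers a chain $D$ if $D\subseteq C$. For $1\le r\le n+1$, $N(n,r)$ is the least number of chains in $B_n$ such that every strict chain $F_1\subset F_2\subset\cdots\subset F_r$ of size $r$ in $B_n$ is covered by at least one of them. Let $\mathcal A_{n,r}$ be the set of integer vectors $(a_0,a_1,\dots,a_r)$ with $a_0,a_r\ge 0$, $a_i\ge 1$ for $1\le i\le r-1$, and $a_0+\cdots+a_r=n$. Define $M(n,r)=\max_{(a_0,\dots,a_r)\in\mathcal A_{n,r}}\binom{n}{a_0,a_1,\dots,a_r}$, where $\binom{n}{a_0,\dots,a_r}=\frac{n!}{a_0!\cdots a_r!}$. Here $\log$ is the natural logarithm. *)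

theory Defs
  imports Complex_Main "HOL-Library.FuncSet"
begin

definition boolean_lattice :: "nat \<Rightarrow> nat set set" where
  "boolean_lattice n = Pow {1..n}"

definition is_chain :: "nat \<Rightarrow> nat set set \<Rightarrow> bool" where
  "is_chain n C \<longleftrightarrow> subset.chain (boolean_lattice n) C"

definition covers :: "nat set set \<Rightarrow> nat set set \<Rightarrow> bool" where
  "covers C D \<longleftrightarrow> D \<subseteq> C"

text \<open>A strict chain \<open>F\<^sub>1 \<subset> \<dots> \<subset> F\<^sub>r\<close> is represented by its set of \<open>r\<close> members.
  No finiteness condition is needed on a family of chains, since \<open>boolean_lattice n\<close>
  is finite.\<close>

definition covering_family :: "nat \<Rightarrow> nat \<Rightarrow> nat set set set \<Rightarrow> bool" where
  "covering_family n r \<C> \<longleftrightarrow>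
     (\<forall>C\<in>\<C>. is_chain n C) \<and>
     (\<forall>D. is_chain n D \<and> card D = r \<longrightarrow> (\<exists>C\<in>\<C>. covers C D))"

definition N :: "nat \<Rightarrow> nat \<Rightarrow> nat" where
  "N n r = (LEAST k. \<exists>\<C>. covering_family n r \<C> \<and> card \<C> = k)"

text \<open>Since all entries are nonnegative, integer vectors are taken with entries in
  \<^typ>\<open>nat\<close>; they are extensional functions on the index set \<open>{0, \<dots>, r}\<close>.\<close>

definition index_vectors :: "nat \<Rightarrow> nat \<Rightarrow> (nat \<Rightarrow> nat) set" where
  "index_vectors n r =
     {a \<in> {0..r} \<rightarrow>\<^sub>E UNIV. (\<forall>i\<in>{1..<r}. 1 \<le> a i) \<and> (\<Sum>i=0..r. a i) = n}"

definition multinomial :: "nat \<Rightarrow> nat \<Rightarrow> (nat \<Rightarrow> nat) \<Rightarrow> real" where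
  "multinomial n r a = fact n / (\<Prod>i=0..r. fact (a i))"

text \<open>The maximum is over a nonempty set exactly when \<open>r \<le> n + 1\<close> (for \<open>r \<ge> 1\<close>);
  outside this range \<open>M n r\<close> is an unspecified value.\<close>

definition M :: "nat \<Rightarrow> nat \<Rightarrow> real" where
  "M n r = Max (multinomial n r ` index_vectors n r)"

end

theory Submission
  imports Defs "HOL-Combinatorics.Multiset_Permutations" "HOL-Real_Asymp.Real_Asymp"
begin

text \<open>Let the type of a chain \<open>F\<^sub>1 \<subset> \<dots> \<subset> F\<^sub>r\<close> be the vector of its gaps, starting from the empty set
  and ending at the full set. Out of the \<open>n!\<close> flags (maximal chains), \<open>\<Prod>\<^sub>i a\<^sub>i!\<close> pass through a given
  chain of type \<open>a\<close>. A random flag therefore covers it with probability at least \<open>1 / M(n, r)\<close>, and there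
  are at most as many chains of type \<open>a\<close> as the multinomial coefficient of \<open>a\<close>.

  Weighting all flags equally thus gives a fractional cover of total weight \<open>M(n, r)\<close>. The greedy
  algorithm turns a fractional cover into an honest one at the cost of a factor \<open>ln d + O(1)\<close>, where
  \<open>d\<close> is the largest number of chains covered by one flag (\<open>greedy_cover\<close>). Applied to all \<open>r\<close>-chains
  this has \<open>d \<approx> n\<^sup>r\<close> and would give the constant \<open>r\<close>.

  To gain the factor \<open>1/2\<close>, only the central chains are covered in this way, those whose gaps all lie
  within \<open>w = sqrt n * ln n\<close> of the mean \<open>n / (r + 1)\<close>. A flag contains at most one chain of
  each type and there are at most \<open>(2 w + 1)\<^sup>r\<close> central types, so now \<open>ln d = (r/2 + o(1)) ln n\<close>
  (\<open>flags_cover_central_chains\<close>). All other types have two gaps that differ by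
  more than \<open>w\<close>; balancing these two increases the multinomial coefficient by a factor
  \<open>exp (w\<^sup>2 / (32 n)) = exp ((ln n)\<^sup>2 / 32)\<close> (\<open>multinomial_decay\<close>). That is superpolynomial, whereas the
  number of types is polynomial, so there are at most \<open>M(n, r)\<close> remaining
  chains in total for large \<open>n\<close>, and each can serve as its own cover.\<close>

section \<open>Greedy covering\<close>

text \<open>Double counting of the incidences between \<open>P\<close> and \<open>Y\<close>: a uniformly random \<open>p\<close> is incident
  with each point of \<open>Y\<close> with probability at least \<open>1 / m\<close>, so some \<open>p\<close> reaches the average.\<close>
lemma exists_above_average:
  fixes R :: "'p \<Rightarrow> 'x \<Rightarrow> bool" and m :: real
  assumes fin: "finite Y" "finite P" "P \<noteq> {}"
    and deg: "\<And>x. x \<in> Y \<Longrightarrow> real (card P) \<le> m * real (card {p\<in>P. R p x})"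
  shows "\<exists>p\<in>P. real (card Y) \<le> m * real (card {x\<in>Y. R p x})"
proof (rule ccontr)
  assume "\<not> ?thesis"
  then have *: "\<And>p. p \<in> P \<Longrightarrow> m * real (card {x\<in>Y. R p x}) < real (card Y)"
    by (auto simp: not_le)
  have "real (card Y) * real (card P) \<le> (\<Sum>x\<in>Y. m * real (card {p\<in>P. R p x}))"
    using sum_mono[of Y "\<lambda>_. real (card P)", OF deg] by simp
  also have "\<dots> = m * (\<Sum>x\<in>Y. \<Sum>p\<in>P. of_bool (R p x))"
    by (simp add: sum_distrib_left fin Int_def)
  also have "\<dots> = m * (\<Sum>p\<in>P. \<Sum>x\<in>Y. of_bool (R p x))"
    by (subst sum.swap) simp
  also have "\<dots> = (\<Sum>p\<in>P. m * real (card {x\<in>Y. R p x}))"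
    by (simp add: sum_distrib_left fin Int_def)
  also have "\<dots> < (\<Sum>p\<in>P. real (card Y))"
    using fin * by (intro sum_strict_mono) auto
  finally show False by (simp add: mult.commute)
qed

text \<open>Always taking a set that is above average for the points not yet covered removes a fraction
  \<open>1 / m\<close> of them each time.\<close>
lemma greedy_steps:
  fixes R :: "'p \<Rightarrow> 'x \<Rightarrow> bool" and m :: real
  assumes fin: "finite X" "finite P" "P \<noteq> {}" and m: "m \<ge> 1"
    and deg: "\<And>x. x \<in> X \<Longrightarrow> real (card P) \<le> m * real (card {p\<in>P. R p x})"
  shows "\<exists>Q\<subseteq>P. card Q \<le> t \<and>
           real (card {x\<in>X. \<forall>p\<in>Q. \<not> R p x}) \<le> (1 - 1 / m) ^ t * real (card X)"
proof (induction t)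
  case 0
  then show ?case by (intro exI[of _ "{}"]) auto
next
  case (Suc t)
  then obtain Q where Q: "Q \<subseteq> P" "card Q \<le> t"
    "real (card {x\<in>X. \<forall>p\<in>Q. \<not> R p x}) \<le> (1 - 1 / m) ^ t * real (card X)" by blast
  define Y where "Y = {x\<in>X. \<forall>p\<in>Q. \<not> R p x}"
  have finY: "finite Y" using fin by (auto simp: Y_def)
  obtain p where p: "p \<in> P" "real (card Y) \<le> m * real (card {x\<in>Y. R p x})"
    using exists_above_average[of Y P m R] fin finY deg by (auto simp: Y_def)
  have "{x\<in>X. \<forall>q\<in>insert p Q. \<not> R q x} = Y - {x\<in>Y. R p x}"
    by (auto simp: Y_def)
  then have "real (card {x\<in>X. \<forall>q\<in>insert p Q. \<not> R q x}) = real (card Y) - real (card {x\<in>Y. R p x})"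
    using finY by (simp add: card_Diff_subset of_nat_diff card_mono)
  also have "\<dots> \<le> (1 - 1 / m) * real (card Y)"
    using p m by (simp add: field_simps)
  also have "\<dots> \<le> (1 - 1 / m) * ((1 - 1 / m) ^ t * real (card X))"
    using Q m by (intro mult_left_mono) (auto simp: Y_def)
  finally have "real (card {x\<in>X. \<forall>q\<in>insert p Q. \<not> R q x}) \<le> (1 - 1 / m) ^ Suc t * real (card X)"
    by simp
  moreover have "card (insert p Q) \<le> Suc t"
    using Q by (metis Suc_le_mono card_insert_if finite_subset fin(2) le_SucI)
  ultimately show ?case using Q p by (intro exI[of _ "insert p Q"]) auto
qed

text \<open>The bound depends on the size \<open>d\<close> of the largest set only, not on the number of points: by double
  counting there are at most \<open>m * d\<close> points, so about \<open>m * ln d\<close> greedy steps leave at most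
  \<open>m\<close> of them, and these can afford a set each.\<close>
lemma greedy_cover:
  fixes R :: "'p \<Rightarrow> 'x \<Rightarrow> bool" and m d :: real
  assumes fin: "finite X" "finite P" "P \<noteq> {}" and m: "m \<ge> 1" and d: "d \<ge> 1"
    and deg: "\<And>x. x \<in> X \<Longrightarrow> real (card P) \<le> m * real (card {p\<in>P. R p x})"
    and size: "\<And>p. p \<in> P \<Longrightarrow> real (card {x\<in>X. R p x}) \<le> d"
  shows "\<exists>Q\<subseteq>P. (\<forall>x\<in>X. \<exists>p\<in>Q. R p x) \<and> real (card Q) \<le> m * (ln d + 1) + 1"
proof -
  define t where "t = nat \<lceil>m * ln d\<rceil>"
  have "0 \<le> m * ln d" using m d by simp
  then have t: "m * ln d \<le> real t" "real t \<le> m * ln d + 1"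
    unfolding t_def by linarith+
  obtain Q where Q: "Q \<subseteq> P" "card Q \<le> t"
    "real (card {x\<in>X. \<forall>p\<in>Q. \<not> R p x}) \<le> (1 - 1 / m) ^ t * real (card X)"
    using greedy_steps[where R = R and t = t, OF fin m deg] by blast
  obtain p0 where p0: "p0 \<in> P" "real (card X) \<le> m * real (card {x\<in>X. R p0 x})"
    using exists_above_average[where R = R, OF fin deg] by blast
  have X: "real (card X) \<le> m * d"
    using p0 size[of p0] m by (smt (verit) mult_left_mono)
  have "(1 - 1 / m) ^ t \<le> exp (- 1 / m) ^ t"
    using m exp_ge_add_one_self[of "- 1 / m"] by (intro power_mono) auto
  also have "\<dots> = exp (- real t / m)"
    by (simp add: exp_of_nat_mult[symmetric])
  also have "\<dots> \<le> exp (- ln d)"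
    using t m by (simp add: field_simps)
  also have "\<dots> = 1 / d" using d by (simp add: exp_minus divide_inverse)
  finally have "(1 - 1 / m) ^ t * real (card X) \<le> 1 / d * (m * d)"
    using X d by (intro mult_mono) auto
  then have left: "real (card {x\<in>X. \<forall>p\<in>Q. \<not> R p x}) \<le> m" using Q(3) d by simp
  have "\<exists>p\<in>P. R p x" if "x \<in> X" for x
  proof (rule ccontr)
    assume "\<not> ?thesis"
    then have "{p\<in>P. R p x} = {}" by blast
    with deg[OF that] fin show False by simp
  qed
  then obtain g where g: "\<And>x. x \<in> X \<Longrightarrow> g x \<in> P \<and> R (g x) x" by metis
  define Q' where "Q' = Q \<union> g ` {x\<in>X. \<forall>p\<in>Q. \<not> R p x}"
  have "card Q' \<le> card Q + card {x\<in>X. \<forall>p\<in>Q. \<not> R p x}"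
    unfolding Q'_def using fin by (intro order_trans[OF card_Un_le] add_left_mono card_image_le) simp
  then have "real (card Q') \<le> m * (ln d + 1) + 1"
    using left t Q(2) by (simp add: algebra_simps)
  moreover have "\<forall>x\<in>X. \<exists>p\<in>Q'. R p x" using g by (auto simp: Q'_def)
  moreover have "Q' \<subseteq> P" using Q g by (auto simp: Q'_def)
  ultimately show ?thesis by blast
qed

section \<open>Flags and chains of a given type\<close>

text \<open>The members of the maximal chain (the flag) that adds the elements of \<open>xs\<close> one at a time.\<close>
definition prefix_sets :: "'a list \<Rightarrow> 'a set set" where
  "prefix_sets xs = (\<lambda>k. set (take k xs)) ` {0..length xs}"

text \<open>The chain \<open>F 1 \<subseteq> \<dots> \<subseteq> F r\<close> is padded by \<open>F 0 = {}\<close> and \<open>F (r + 1) = A\<close>, so that the type \<open>a\<close>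
  lists all \<open>r + 1\<close> consecutive gaps and its entries sum to \<open>card A\<close>.\<close>
definition chains_of_type :: "'a set \<Rightarrow> nat \<Rightarrow> (nat \<Rightarrow> nat) \<Rightarrow> 'a set set set" where
  "chains_of_type A r a =
     {D. \<exists>F. F 0 = {} \<and> F (Suc r) = A \<and>
             (\<forall>i\<le>r. F i \<subseteq> F (Suc i) \<and> card (F (Suc i) - F i) = a i) \<and> D = F ` {1..r}}"

lemma prefix_sets_append: "F \<in> prefix_sets ys \<Longrightarrow> F \<in> prefix_sets (ys @ zs)"
  unfolding prefix_sets_def by (fastforce simp: image_iff intro: bexI[of _ k for k])

lemma prefix_sets_self: "set xs \<in> prefix_sets xs"
  unfolding prefix_sets_def by (auto simp: image_iff intro!: bexI[of _ "length xs"])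

lemma subset_top_of_chain:
  assumes "\<And>i. i < k \<Longrightarrow> F i \<subseteq> F (Suc i)" "i \<le> k"
  shows "F i \<subseteq> F k"
  using assms(2)
proof (induction rule: inc_induct)
  case (step i)
  then show ?case using assms(1)[of i] by blast
qed simp

lemma sum_card_Diff_chain:
  assumes "F 0 = {}" "\<And>i. i < k \<Longrightarrow> F i \<subseteq> F (Suc i)" "finite (F k)"
  shows "(\<Sum>i<k. card (F (Suc i) - F i)) = card (F k)"
  using assms
proof (induction k)
  case (Suc k)
  then have sub: "F k \<subseteq> F (Suc k)" and fin: "finite (F k)"
    using finite_subset by blast+
  then have "card (F (Suc k) - F k) + card (F k) = card (F (Suc k))"
    using Suc.prems by (simp add: card_Diff_subset card_mono)
  then show ?case using Suc fin by simp
qed simp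

text \<open>A flag of \<open>F k\<close> through \<open>F 0, \<dots>, F k\<close> may order each difference \<open>F (i + 1) - F i\<close> freely;
  concatenating the orderings gives distinct flags.\<close>
lemma card_flags_through_ge:
  assumes "F 0 = {}" "\<And>i. i < k \<Longrightarrow> F i \<subseteq> F (Suc i)" "finite (F k)"
  shows "(\<Prod>i<k. fact (card (F (Suc i) - F i))) \<le>
           card {xs\<in>permutations_of_set (F k). \<forall>i\<le>k. F i \<in> prefix_sets xs}"
  using assms
proof (induction k)
  case 0
  have "{xs\<in>permutations_of_set (F 0). \<forall>i\<le>0. F i \<in> prefix_sets xs} = {[]}"
    using 0 by (auto simp: prefix_sets_def)
  then show ?case by simp
next
  case (Suc k)
  define S where "S = {xs\<in>permutations_of_set (F k). \<forall>i\<le>k. F i \<in> prefix_sets xs}"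
  define T where "T = permutations_of_set (F (Suc k) - F k)"
  define U where "U = {xs\<in>permutations_of_set (F (Suc k)). \<forall>i\<le>Suc k. F i \<in> prefix_sets xs}"
  have sub: "F k \<subseteq> F (Suc k)" using Suc.prems by auto
  then have fin: "finite (F k)" "finite (F (Suc k) - F k)" using Suc.prems(3) finite_subset by blast+
  have IH: "(\<Prod>i<k. fact (card (F (Suc i) - F i))) \<le> card S"
    using Suc fin unfolding S_def by auto
  have inj: "inj_on (\<lambda>(ys, zs). ys @ zs) (S \<times> T)"
  proof (rule inj_onI, clarify)
    fix ys zs ys' zs'
    assume "ys \<in> S" "ys' \<in> S" "ys @ zs = ys' @ zs'"
    moreover from this have "length ys = length ys'"
      by (auto simp: S_def permutations_of_set_def) (metis distinct_card)
    ultimately show "ys = ys' \<and> zs = zs'" by simp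
  qed
  have "(\<lambda>(ys, zs). ys @ zs) ` (S \<times> T) \<subseteq> U"
  proof clarify
    fix ys zs assume *: "ys \<in> S" "zs \<in> T"
    have perm: "ys @ zs \<in> permutations_of_set (F (Suc k))"
      using * sub by (auto simp: S_def T_def permutations_of_set_def)
    moreover have "F i \<in> prefix_sets (ys @ zs)" if "i \<le> Suc k" for i
    proof (cases "i = Suc k")
      case True
      then show ?thesis using prefix_sets_self[of "ys @ zs"] perm
        by (simp add: permutations_of_set_def)
    next
      case False
      then show ?thesis using * that by (auto simp: S_def intro: prefix_sets_append)
    qed
    ultimately show "ys @ zs \<in> U" by (auto simp: U_def)
  qed
  moreover have "finite U" by (simp add: U_def)
  ultimately have "card (S \<times> T) \<le> card U" using inj card_inj_on_le by blast
  then have "card S * fact (card (F (Suc k) - F k)) \<le> card U"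
    using fin by (simp add: card_cartesian_product T_def)
  then show ?case using IH unfolding U_def
    by (simp add: mult.commute[of "fact _"]) (meson le_trans mult_le_mono1)
qed

lemma card_flags_through_chain_ge:
  assumes "finite A" "D \<in> chains_of_type A r a"
  shows "(\<Prod>i=0..r. fact (a i)) \<le> card {xs\<in>permutations_of_set A. D \<subseteq> prefix_sets xs}"
proof -
  obtain F where F: "F 0 = {}" "F (Suc r) = A" "D = F ` {1..r}"
    "\<And>i. i \<le> r \<Longrightarrow> F i \<subseteq> F (Suc i) \<and> card (F (Suc i) - F i) = a i"
    using assms by (auto simp: chains_of_type_def)
  have "(\<Prod>i=0..r. fact (a i)) = (\<Prod>i<Suc r. fact (card (F (Suc i) - F i)) :: nat)"
    using F by (intro prod.cong) auto
  also have "\<dots> \<le> card {xs\<in>permutations_of_set (F (Suc r)). \<forall>i\<le>Suc r. F i \<in> prefix_sets xs}"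
    using F assms by (intro card_flags_through_ge) auto
  also have "\<dots> \<le> card {xs\<in>permutations_of_set A. D \<subseteq> prefix_sets xs}"
    using F by (intro card_mono) auto
  finally show ?thesis .
qed

text \<open>A flag has only one member of each size, and the type prescribes the sizes. Hence a flag contains
  at most one chain of each type.\<close>
lemma chain_of_type_in_flag:
  assumes "finite A" "D \<in> chains_of_type A r a" "xs \<in> permutations_of_set A" "D \<subseteq> prefix_sets xs"
  shows "D = (\<lambda>i. set (take (\<Sum>j<i. a j) xs)) ` {1..r}"
proof -
  obtain F where F: "F 0 = {}" "F (Suc r) = A" "D = F ` {1..r}"
    "\<And>i. i \<le> r \<Longrightarrow> F i \<subseteq> F (Suc i) \<and> card (F (Suc i) - F i) = a i"
    using assms by (auto simp: chains_of_type_def)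
  have card: "card (F i) = (\<Sum>j<i. a j)" if i: "i \<le> Suc r" for i
  proof -
    have "finite (F i)"
      using subset_top_of_chain[of "Suc r" F i] F i assms(1) by (metis finite_subset less_Suc_eq_le)
    then have "card (F i) = (\<Sum>j<i. card (F (Suc j) - F j))"
      using F i by (intro sum_card_Diff_chain[symmetric]) auto
    also have "\<dots> = (\<Sum>j<i. a j)"
      using F(4) i by (intro sum.cong) auto
    finally show ?thesis .
  qed
  have "F i = set (take (\<Sum>j<i. a j) xs)" if i: "i \<in> {1..r}" for i
  proof -
    have "F i \<in> prefix_sets xs" using i F assms by auto
    then obtain k where k: "k \<le> length xs" "F i = set (take k xs)"
      by (auto simp: prefix_sets_def)
    have "distinct xs" using assms by (simp add: permutations_of_set_def)
    then have "card (F i) = k" using k by (simp add: distinct_card)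
    then have "k = (\<Sum>j<i. a j)" using card[of i] i by simp
    then show ?thesis using k by simp
  qed
  then show ?thesis using F by auto
qed

lemma finite_chains_of_type:
  assumes "finite A" shows "finite (chains_of_type A r a)"
proof -
  have "chains_of_type A r a \<subseteq> Pow (Pow A)"
  proof
    fix D assume "D \<in> chains_of_type A r a"
    then obtain F where F: "F (Suc r) = A" "\<forall>i\<le>r. F i \<subseteq> F (Suc i)" "D = F ` {1..r}"
      unfolding chains_of_type_def by blast
    have "F i \<subseteq> A" if "i \<in> {1..r}" for i
      using F(1,2) that subset_top_of_chain[of "Suc r" F i] by (simp add: less_Suc_eq_le)
    then show "D \<in> Pow (Pow A)" using F(3) by blast
  qed
  then show ?thesis using assms finite_subset by blast
qed

text \<open>By the previous lemmas the flags through different chains of one type form disjoint sets, each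
  with at least \<open>\<Prod>i=0..r. fact (a i)\<close> of the \<open>fact (card A)\<close> flags.\<close>
lemma card_chains_of_type_le:
  assumes "finite A"
  shows "card (chains_of_type A r a) * (\<Prod>i=0..r. fact (a i)) \<le> fact (card A)"
proof -
  let ?T = "\<lambda>D. {xs\<in>permutations_of_set A. D \<subseteq> prefix_sets xs}"
  let ?C = "chains_of_type A r a"
  have "card ?C * (\<Prod>i=0..r. fact (a i)) = (\<Sum>D\<in>?C. \<Prod>i=0..r. fact (a i))"
    by (simp only: sum_constant of_nat_id)
  also have "\<dots> \<le> (\<Sum>D\<in>?C. card (?T D))"
    by (intro sum_mono card_flags_through_chain_ge assms)
  also have "\<dots> = card (\<Union>D\<in>?C. ?T D)"
  proof (rule card_UN_disjoint[symmetric])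
    have "D = E" if "D \<in> ?C" "E \<in> ?C" "xs \<in> ?T D" "xs \<in> ?T E" for D E xs
    proof -
      have "D = (\<lambda>i. set (take (\<Sum>j<i. a j) xs)) ` {1..r}"
        by (rule chain_of_type_in_flag[OF assms that(1)]) (use that in auto)
      moreover have "E = (\<lambda>i. set (take (\<Sum>j<i. a j) xs)) ` {1..r}"
        by (rule chain_of_type_in_flag[OF assms that(2)]) (use that in auto)
      ultimately show ?thesis by (rule trans[OF _ sym])
    qed
    then show "\<forall>D\<in>?C. \<forall>E\<in>?C. D \<noteq> E \<longrightarrow> ?T D \<inter> ?T E = {}"
      by (metis (no_types, lifting) disjoint_iff)
  qed (auto simp: finite_chains_of_type assms)
  also have "\<dots> \<le> card (permutations_of_set A)"
    by (intro card_mono) auto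
  finally show ?thesis using assms by simp
qed

lemma finite_chain_sorted:
  assumes "finite D" "subset.chain UNIV D"
  shows "\<exists>Fs. set Fs = D \<and> sorted_wrt (\<subset>) Fs"
  using assms
proof (induction D rule: finite_psubset_induct)
  case (psubset D)
  show ?case
  proof (cases "D = {}")
    case True
    then show ?thesis by (intro exI[of _ "[]"]) auto
  next
    case False
    then have m: "\<Union>D \<in> D"
      using Union_in_chain[OF psubset.hyps] psubset.prems by blast
    then have "D - {\<Union>D} \<subset> D" by blast
    moreover have "subset.chain UNIV (D - {\<Union>D})"
      using psubset.prems by (simp add: subset_chain_def)
    ultimately obtain Fs where Fs: "set Fs = D - {\<Union>D}" "sorted_wrt (\<subset>) Fs"
      using psubset.IH[of "D - {\<Union>D}"] by metis
    have "X \<subset> \<Union>D" if "X \<in> set Fs" for X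
      using that unfolding Fs(1) by (auto simp: psubset_eq)
    then have "sorted_wrt (\<subset>) (Fs @ [\<Union>D])"
      using Fs by (simp add: sorted_wrt_append)
    moreover have "set (Fs @ [\<Union>D]) = D" using Fs m by auto
    ultimately show ?thesis by blast
  qed
qed

lemma chain_has_type:
  assumes r: "r \<ge> 1" and D: "is_chain n D" "card D = r"
  shows "\<exists>a\<in>index_vectors n r. D \<in> chains_of_type {1..n} r a"
proof -
  have sub: "D \<subseteq> Pow {1..n}" and ch: "subset.chain UNIV D"
    using D by (auto simp: is_chain_def boolean_lattice_def subset_chain_def)
  then have fin: "finite D" by (meson finite_Pow_iff finite_atLeastAtMost finite_subset)
  obtain Fs where Fs: "set Fs = D" "sorted_wrt (\<subset>) Fs"
    using finite_chain_sorted[OF fin ch] by blast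
  have "distinct Fs"
    using Fs(2) by (auto simp: distinct_conv_nth sorted_wrt_iff_nth_less nat_neq_iff)
  then have len: "length Fs = r" using Fs D by (auto simp: distinct_card)
  define F where "F = (\<lambda>i. ({} # Fs @ [{1..n}]) ! i)"
  have F0: "F 0 = {}" and FS: "F (Suc r) = {1..n}"
    using len by (auto simp: F_def nth_append)
  have F_nth: "F i = Fs ! (i - 1)" if "i \<in> {1..r}" for i
    using that len by (cases i) (auto simp: F_def nth_append)
  have FD: "D = F ` {1..r}"
  proof -
    have "F ` {1..r} = F ` Suc ` {..<r}"
      by (simp add: image_Suc_lessThan)
    also have "\<dots> = (\<lambda>i. Fs ! i) ` {..<r}"
      unfolding image_image using F_nth by (intro image_cong) auto
    also have "\<dots> = set Fs" using len by (auto simp: set_conv_nth)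
    finally show ?thesis using Fs by simp
  qed
  have strict: "F i \<subset> F (Suc i)" if "i \<in> {1..<r}" for i
    using that Fs(2) len F_nth[of i] F_nth[of "Suc i"]
    by (auto simp: sorted_wrt_iff_nth_less)
  have sub': "F i \<subseteq> {1..n}" if "i \<le> Suc r" for i
  proof -
    have "i = 0 \<or> i = Suc r \<or> i \<in> {1..r}" using that by auto
    moreover have "F i \<subseteq> {1..n}" if "i \<in> {1..r}" using that sub FD by blast
    ultimately show ?thesis using F0 FS by auto
  qed
  have mono: "F i \<subseteq> F (Suc i)" if "i \<le> r" for i
  proof -
    have "i = 0 \<or> i = r \<or> i \<in> {1..<r}" using that by auto
    then show ?thesis using F0 FS sub'[of r] strict[of i] by auto
  qed
  have finF: "finite (F i)" if "i \<le> Suc r" for i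
    using sub'[OF that] finite_subset by blast
  define a where "a = restrict (\<lambda>i. card (F (Suc i) - F i)) {0..r}"
  have "(\<Sum>i<Suc r. card (F (Suc i) - F i)) = card (F (Suc r))"
    using F0 mono finF by (intro sum_card_Diff_chain) auto
  moreover have "(\<Sum>i=0..r. a i) = (\<Sum>i<Suc r. card (F (Suc i) - F i))"
    by (intro sum.cong) (auto simp: a_def)
  ultimately have "(\<Sum>i=0..r. a i) = n" by (simp add: FS)
  moreover have "1 \<le> a i" if "i \<in> {1..<r}" for i
  proof -
    have "F (Suc i) - F i \<noteq> {}" using strict[OF that] by blast
    then have "card (F (Suc i) - F i) \<noteq> 0" using finF[of "Suc i"] that by auto
    then show ?thesis using that by (simp add: a_def)
  qed
  moreover have "a \<in> {0..r} \<rightarrow>\<^sub>E UNIV" by (simp add: a_def)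
  ultimately have "a \<in> index_vectors n r" by (simp add: index_vectors_def)
  moreover have "D \<in> chains_of_type {1..n} r a"
    unfolding chains_of_type_def
    by (intro CollectI exI[of _ F] conjI allI impI F0 FS FD mono) (simp_all add: a_def)
  ultimately show ?thesis by blast
qed

section \<open>Multinomial coefficients away from the centre\<close>

lemma fact_add_ge_power: "(real u + 1) ^ t * fact u \<le> fact (u + t)"
proof (induction t)
  case (Suc t)
  have "(real u + 1) ^ Suc t * fact u = (real u + 1) * ((real u + 1) ^ t * fact u)" by simp
  also have "\<dots> \<le> (real u + real t + 1) * fact (u + t)"
    using Suc by (intro mult_mono) auto
  finally show ?case by (simp add: algebra_simps)
qed simp

lemma fact_add_le_power: "s \<le> t \<Longrightarrow> fact (y + s) \<le> (real y + real t) ^ s * fact y"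
proof (induction s)
  case (Suc s)
  have "fact (y + Suc s) = (real y + real s + 1) * fact (y + s)" by (simp add: algebra_simps)
  also have "\<dots> \<le> (real y + real t) * ((real y + real t) ^ s * fact y)"
    using Suc by (intro mult_mono) auto
  finally show ?case by simp
qed simp

text \<open>Moving \<open>t\<close> units from the larger to the smaller of two parts divides the product of their
  factorials by a quotient of \<open>t\<close> factors \<open>u + 1, \<dots>, u + t\<close> over \<open>t\<close> factors \<open>y + 1, \<dots>, y + t\<close>, which
  is at least \<open>\<rho> ^ t\<close> as soon as the extreme factors \<open>u + 1\<close> and \<open>y + t\<close> have ratio at least \<open>\<rho>\<close>.\<close>
lemma fact_mult_balance:
  assumes "\<rho> \<ge> 0" "\<rho> * (real y + real t) \<le> real u + 1"
  shows "\<rho> ^ t * (fact u * fact (y + t)) \<le> fact (u + t) * (fact y :: real)"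
proof -
  have "\<rho> ^ t * (fact u * fact (y + t)) \<le> \<rho> ^ t * (fact u * ((real y + real t) ^ t * fact y))"
    using assms fact_add_le_power[of t t y] by (intro mult_left_mono) auto
  also have "\<dots> = (\<rho> * (real y + real t)) ^ t * (fact u * fact y)"
    by (simp add: power_mult_distrib)
  also have "\<dots> \<le> (real u + 1) ^ t * (fact u * fact y)"
    using assms by (intro mult_right_mono power_mono) auto
  also have "\<dots> \<le> fact (u + t) * fact y"
    using mult_right_mono[OF fact_add_ge_power[of u t], of "fact y"] by (simp add: mult.assoc)
  finally show ?thesis .
qed

lemma exp_half_le: "0 \<le> z \<Longrightarrow> z \<le> 1 \<Longrightarrow> exp (z / 2) \<le> 1 + (z::real)"
proof -
  assume z: "0 \<le> z" "z \<le> 1"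
  have "exp (z / 2) \<le> 1 + z / 2 + (z / 2)\<^sup>2" using z by (intro exp_bound) auto
  also have "\<dots> \<le> 1 + z" using z by (simp add: power2_eq_square field_simps) (smt (verit) mult_left_le)
  finally show ?thesis .
qed

text \<open>If two parts of a composition of \<open>n\<close> differ by \<open>d\<close>, then after moving \<open>t \<approx> d / 4\<close> units they
  still differ by about \<open>d / 2\<close>, so each unit moved gains a factor \<open>1 + d / (2 * n)\<close> and the total gain
  is exponential in \<open>d\<^sup>2 / n\<close>.\<close>
lemma fact_mult_gain:
  assumes "x + y \<le> n" "y + d \<le> x" "d \<ge> 4"
  shows "\<exists>t\<ge>1. y + 2 * t \<le> x \<and>
           exp ((real d)\<^sup>2 / (32 * real n)) * (fact (x - t) * fact (y + t)) \<le> fact x * (fact y :: real)"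
proof -
  define t where "t = d div 4"
  define \<rho> where "\<rho> = 1 + real d / (2 * real n)"
  \<comment> \<open>The hypothesis \<open>d \<ge> 4\<close> makes \<open>t\<close> nonzero, so that rounding loses at most a factor 2.\<close>
  have t: "4 * t \<le> d" "d \<le> 8 * t" "t \<ge> 1" using assms(3) unfolding t_def by presburger+
  have n: "real n > 0" "real d \<le> real n" using assms by auto
  have "\<rho> * (real y + real t) = real y + real t + (real d / 2) * ((real y + real t) / real n)"
    using n by (simp add: \<rho>_def field_simps)
  also have "\<dots> \<le> real y + real t + (real d / 2) * 1"
    using assms t n by (intro add_left_mono mult_left_mono) (auto simp: field_simps)
  also have "\<dots> \<le> real (x - t) + 1"
    using assms t by (simp add: of_nat_diff field_simps)
  finally have "\<rho> ^ t * (fact (x - t) * fact (y + t)) \<le> fact (x - t + t) * (fact y :: real)"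
    using n by (intro fact_mult_balance) (auto simp: \<rho>_def)
  moreover have "exp ((real d)\<^sup>2 / (32 * real n)) \<le> \<rho> ^ t"
  proof -
    have "(real d)\<^sup>2 / (32 * real n) = real d / (4 * real n) * (real d / 8)"
      by (simp add: power2_eq_square)
    also have "\<dots> \<le> real d / (4 * real n) * real t"
      using t n by (intro mult_left_mono) auto
    finally have "exp ((real d)\<^sup>2 / (32 * real n)) \<le> exp ((real d / (2 * real n)) / 2) ^ t"
      by (simp add: exp_of_nat_mult[symmetric] mult.commute)
    also have "\<dots> \<le> \<rho> ^ t"
      unfolding \<rho>_def using n by (intro power_mono exp_half_le) (auto simp: field_simps)
    finally show ?thesis .
  qed
  then have "exp ((real d)\<^sup>2 / (32 * real n)) * (fact (x - t) * fact (y + t))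
      \<le> \<rho> ^ t * (fact (x - t) * (fact (y + t) :: real))"
    by (rule mult_right_mono) simp
  moreover have "x - t + t = x" using t assms by simp
  ultimately have "exp ((real d)\<^sup>2 / (32 * real n)) * (fact (x - t) * fact (y + t)) \<le> fact x * (fact y :: real)"
    by (metis order_trans)
  then show ?thesis using t assms by (intro exI[of _ t]) auto
qed

lemma index_vectors_subset: "index_vectors n r \<subseteq> {0..r} \<rightarrow>\<^sub>E {0..n}"
proof
  fix a assume a: "a \<in> index_vectors n r"
  then have "a i \<le> n" if "i \<in> {0..r}" for i
    using member_le_sum[of i "{0..r}" a] that by (simp add: index_vectors_def)
  then show "a \<in> {0..r} \<rightarrow>\<^sub>E {0..n}"
    using a by (auto simp: index_vectors_def PiE_def Pi_def)
qed

lemma finite_index_vectors: "finite (index_vectors n r)"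
  using finite_subset[OF index_vectors_subset] by (simp add: finite_PiE)

lemma card_index_vectors_le: "card (index_vectors n r) \<le> (n + 1) ^ (r + 1)"
proof -
  have "card (index_vectors n r) \<le> card ({0..r} \<rightarrow>\<^sub>E {0..n})"
    by (intro card_mono index_vectors_subset finite_PiE) auto
  also have "\<dots> = (n + 1) ^ (r + 1)" by (simp add: card_PiE)
  finally show ?thesis .
qed

lemma multinomial_le_M: "a \<in> index_vectors n r \<Longrightarrow> multinomial n r a \<le> M n r"
  unfolding M_def by (intro Max_ge) (auto simp: finite_index_vectors)

text \<open>The quotient of the two sides is a multinomial coefficient, a positive integer.\<close>
lemma prod_fact_le_fact_sum:
  "finite S \<Longrightarrow> (\<Prod>i\<in>S. fact (a i)) \<le> (fact (\<Sum>i\<in>S. a i) :: nat)"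
proof (induction S rule: finite_induct)
  case (insert i S)
  have "fact (a i) * (\<Prod>i\<in>S. fact (a i)) \<le> fact (a i) * (fact (\<Sum>i\<in>S. a i) :: nat)"
    using insert by simp
  also have "\<dots> \<le> fact (a i + (\<Sum>i\<in>S. a i))"
    by (intro dvd_imp_le fact_fact_dvd_fact) simp
  finally show ?case using insert by simp
qed simp

lemma M_ge_1:
  assumes "r \<ge> 1" "r \<le> n"
  shows "M n r \<ge> 1"
proof -
  \<comment> \<open>One admissible vector suffices; the entries between \<open>0\<close> and \<open>r\<close> take their least value 1.\<close>
  define a where "a = restrict (\<lambda>i. if i = 0 then n - (r - 1) else if i = r then 0 else 1) {0..r}"
  have "{0..r} = insert 0 (insert r {1..<r})" using assms by auto
  then have "(\<Sum>i=0..r. a i) = n - (r - 1) + (\<Sum>i\<in>{1..<r}. 1)"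
    using assms by (simp add: a_def)
  then have sum: "(\<Sum>i=0..r. a i) = n" using assms by simp
  then have a: "a \<in> index_vectors n r" by (auto simp: index_vectors_def a_def)
  have "real (\<Prod>i=0..r. fact (a i)) \<le> real (fact n)"
    using prod_fact_le_fact_sum[of "{0..r}" a] sum by (simp only: of_nat_le_iff finite_atLeastAtMost)
  then have "1 \<le> multinomial n r a"
    by (simp add: multinomial_def prod_pos)
  then show ?thesis using multinomial_le_M[OF a] by simp
qed

text \<open>If one entry is far from the mean \<open>n / (r + 1)\<close>, then some entry lies on the other side of the
  mean, so two entries differ by more than \<open>w\<close>. Balancing these two yields an admissible vector whose
  multinomial coefficient is larger by the stated factor, and still at most \<open>M n r\<close>.\<close>
lemma multinomial_decay:
  assumes a: "a \<in> index_vectors n r" and i: "i \<le> r" and w: "w \<ge> 4"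
    and far: "\<bar>real (a i) - real n / (real r + 1)\<bar> > w"
  shows "exp (w\<^sup>2 / (32 * real n)) * multinomial n r a \<le> M n r"
proof -
  define c where "c = real n / (real r + 1)"
  have total: "(\<Sum>j=0..r. real (a j)) = (\<Sum>j=0..r. c)"
    using a by (simp add: index_vectors_def c_def add.commute flip: of_nat_sum)
  obtain l where l: "l \<le> r" "real (a l) \<le> c"
  proof (rule ccontr)
    assume "\<not> thesis"
    then have "(\<Sum>j=0..r. c) < (\<Sum>j=0..r. real (a j))"
      using that by (intro sum_strict_mono) (auto simp: not_le[symmetric])
    then show False using total by simp
  qed
  obtain h where h: "h \<le> r" "c \<le> real (a h)"
  proof (rule ccontr)
    assume "\<not> thesis"
    then have "(\<Sum>j=0..r. real (a j)) < (\<Sum>j=0..r. c)"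
      using that by (intro sum_strict_mono) (auto simp: not_le[symmetric])
    then show False using total by simp
  qed
  obtain p q where pq: "p \<le> r" "q \<le> r" "real (a p) - real (a q) > w"
  proof (cases "real (a i) > c + w")
    case True
    then show thesis using that[of i l] i l by simp
  next
    case False
    then have "real (a i) < c - w" using far by (auto simp: c_def)
    then show thesis using that[of h i] i h by simp
  qed
  define d where "d = a p - a q"
  have d: "real d = real (a p) - real (a q)" "a q + d = a p" using pq w by (auto simp: d_def)
  have ne: "p \<noteq> q" using pq w by auto
  define S where "S = {0..r} - {p, q}"
  have S: "{0..r} = insert p (insert q S)" "p \<notin> insert q S" "q \<notin> S" "finite S"
    using pq ne by (auto simp: S_def)
  have split_sum: "(\<Sum>j=0..r. f j) = f p + f q + (\<Sum>j\<in>S. f j)" for f :: "nat \<Rightarrow> nat"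
    using S by simp
  have split_prod: "(\<Prod>j=0..r. f j) = f p * f q * (\<Prod>j\<in>S. f j)" for f :: "nat \<Rightarrow> real"
    using S by simp
  have sum_a: "a p + a q + (\<Sum>j\<in>S. a j) = n"
    using a split_sum[of a] by (simp add: index_vectors_def)
  have "d \<ge> 4" using d pq w by linarith
  then obtain t where t: "t \<ge> 1" "a q + 2 * t \<le> a p"
    "exp ((real d)\<^sup>2 / (32 * real n)) * (fact (a p - t) * fact (a q + t)) \<le> fact (a p) * (fact (a q) :: real)"
    using fact_mult_gain[of "a p" "a q" n d] sum_a d by auto
  define b where "b = a(p := a p - t, q := a q + t)"
  have b_S: "(\<Sum>j\<in>S. b j) = (\<Sum>j\<in>S. a j)" "(\<Prod>j\<in>S. fact (b j)) = (\<Prod>j\<in>S. fact (a j) :: real)"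
    by (auto simp: b_def S_def intro!: sum.cong prod.cong)
  have b_pq: "b p = a p - t" "b q = a q + t" using ne by (auto simp: b_def)
  have "(\<Sum>j=0..r. b j) = n"
    unfolding split_sum b_S b_pq using sum_a t by simp
  moreover have "b \<in> {0..r} \<rightarrow>\<^sub>E UNIV"
    using a pq by (auto simp: b_def index_vectors_def PiE_def extensional_def)
  \<comment> \<open>The donor stays positive: it keeps at least \<open>a q + t\<close> units, and \<open>t \<ge> 1\<close>.\<close>
  moreover have "1 \<le> b j" if "j \<in> {1..<r}" for j
    using a that t by (auto simp: b_def index_vectors_def)
  ultimately have b: "b \<in> index_vectors n r" by (simp add: index_vectors_def)
  define c' where "c' = (\<Prod>j\<in>S. fact (a j) :: real)"
  have c': "c' > 0" by (simp add: c'_def prod_pos)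
  have "exp (w\<^sup>2 / (32 * real n)) \<le> exp ((real d)\<^sup>2 / (32 * real n))"
    using d pq w by (auto intro!: divide_right_mono power_mono)
  then have "exp (w\<^sup>2 / (32 * real n)) * (fact (b p) * fact (b q)) \<le> fact (a p) * (fact (a q) :: real)"
    using t(3) unfolding b_pq by (meson mult_right_mono order_trans fact_ge_zero mult_nonneg_nonneg)
  then have "exp (w\<^sup>2 / (32 * real n)) * multinomial n r a \<le> multinomial n r b"
    using c' unfolding multinomial_def split_prod b_S c'_def[symmetric]
    by (simp add: field_simps mult_left_mono)
  then show ?thesis using multinomial_le_M[OF b] by simp
qed

lemma card_nat_near:
  assumes "w \<ge> 0"
  shows "finite {k::nat. \<bar>real k - c\<bar> \<le> w}" "real (card {k::nat. \<bar>real k - c\<bar> \<le> w}) \<le> 2 * w + 1"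
proof -
  let ?J = "{k::nat. \<bar>real k - c\<bar> \<le> w}" and ?I = "{\<lceil>c - w\<rceil>..\<lfloor>c + w\<rfloor>}"
  have sub: "int ` ?J \<subseteq> ?I"
    by (auto simp: ceiling_le_iff le_floor_iff abs_le_iff)
  then have "finite (int ` ?J)" by (rule finite_subset) simp
  then show "finite ?J" by (rule finite_imageD) simp
  have "card ?J = card (int ` ?J)" by (simp add: card_image)
  also have "\<dots> \<le> card ?I" using sub by (intro card_mono) auto
  finally have "real (card ?J) \<le> real (nat (\<lfloor>c + w\<rfloor> - \<lceil>c - w\<rceil> + 1))" by simp
  also have "\<dots> \<le> 2 * w + 1" using assms by linarith
  finally show "real (card ?J) \<le> 2 * w + 1" .
qed

definition central_vectors :: "nat \<Rightarrow> nat \<Rightarrow> real \<Rightarrow> (nat \<Rightarrow> nat) set" where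
  "central_vectors n r w =
     {a \<in> index_vectors n r. \<forall>i\<le>r. \<bar>real (a i) - real n / (real r + 1)\<bar> \<le> w}"

text \<open>The exponent is \<open>r\<close> and not \<open>r + 1\<close> because the sum determines the last entry.\<close>
lemma card_central_vectors_le:
  assumes "w \<ge> 0"
  shows "real (card (central_vectors n r w)) \<le> (2 * w + 1) ^ r"
proof -
  let ?J = "{k::nat. \<bar>real k - real n / (real r + 1)\<bar> \<le> w}"
  let ?f = "\<lambda>a. restrict a {0..<r}"
  have "inj_on ?f (central_vectors n r w)"
  proof (rule inj_onI)
    fix a b assume ab: "a \<in> central_vectors n r w" "b \<in> central_vectors n r w" and eq: "?f a = ?f b"
    have low: "a i = b i" if "i < r" for i
      using fun_cong[OF eq, of i] that by simp
    have "sum a {0..<r} + a r = sum b {0..<r} + b r"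
      using ab by (simp add: central_vectors_def index_vectors_def atLeastLessThanSuc_atLeastAtMost[symmetric])
    then have "a r = b r" using low by simp
    with low have "a i = b i" if "i \<in> {0..r}" for i
      using that by (cases "i = r") auto
    then show "a = b"
      using ab by (intro PiE_ext[of a "{0..r}" "\<lambda>_. UNIV" b]) (auto simp: central_vectors_def index_vectors_def)
  qed
  moreover have "?f ` central_vectors n r w \<subseteq> {0..<r} \<rightarrow>\<^sub>E ?J"
    by (auto simp: central_vectors_def)
  moreover have "finite ({0..<r} \<rightarrow>\<^sub>E ?J)"
    using card_nat_near(1)[OF assms] by (intro finite_PiE) auto
  ultimately have "card (central_vectors n r w) \<le> card ({0..<r} \<rightarrow>\<^sub>E ?J)"
    by (rule card_inj_on_le)
  also have "\<dots> = card ?J ^ r" by (simp add: card_PiE)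
  finally have "real (card (central_vectors n r w)) \<le> real (card ?J) ^ r"
    by (metis of_nat_le_iff of_nat_power)
  also have "\<dots> \<le> (2 * w + 1) ^ r"
    using card_nat_near(2)[OF assms] by (intro power_mono) auto
  finally show ?thesis .
qed

section \<open>Covering the chains of the Boolean lattice\<close>

lemma prefix_sets_is_chain:
  assumes "xs \<in> permutations_of_set {1..n}"
  shows "is_chain n (prefix_sets xs)"
proof -
  have "X \<subseteq> {1..n}" if "X \<in> prefix_sets xs" for X
    using that assms set_take_subset[of _ xs] by (auto simp: prefix_sets_def permutations_of_set_def)
  moreover have "X \<subseteq> Y \<or> Y \<subseteq> X" if XY: "X \<in> prefix_sets xs" "Y \<in> prefix_sets xs" for X Y
  proof -
    obtain k l where "X = set (take k xs)" "Y = set (take l xs)"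
      using XY by (auto simp: prefix_sets_def)
    then show ?thesis
      using set_take_subset_set_take[of k l xs] set_take_subset_set_take[of l k xs] by (cases "k \<le> l") auto
  qed
  ultimately show ?thesis
    unfolding is_chain_def boolean_lattice_def subset_chain_def by blast
qed

lemma N_le:
  assumes \<C>: "covering_family n r \<C>"
  shows "N n r \<le> card \<C>"
  unfolding N_def using \<C> by (intro Least_le) blast

lemma card_chains_of_type_le_multinomial:
  "real (card (chains_of_type {1..n} r a)) \<le> multinomial n r a"
proof -
  let ?p = "\<Prod>i=0..r. fact (a i) :: nat"
  have "card (chains_of_type {1..n} r a) * ?p \<le> fact n"
    using card_chains_of_type_le[of "{1..n}" r a] by simp
  then have "real (card (chains_of_type {1..n} r a)) * real ?p \<le> fact n"
    by (metis of_nat_fact of_nat_le_iff of_nat_mult)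
  then show ?thesis
    by (simp add: multinomial_def pos_le_divide_eq prod_pos)
qed

text \<open>Here \<open>greedy_cover\<close> is applied with flags as the covering sets. A chain of type \<open>a\<close> lies in a
  fraction at least \<open>1 / multinomial n r a \<ge> 1 / M n r\<close> of all flags, and a flag contains at most one
  chain for each central vector, that is at most \<open>(2 * w + 1) ^ r\<close> chains to be covered.\<close>
lemma flags_cover_central_chains:
  assumes r: "r \<ge> 1" "r \<le> n" and w: "w \<ge> 0"
  shows "\<exists>Q\<subseteq>permutations_of_set {1..n}.
           (\<forall>a\<in>central_vectors n r w. \<forall>D\<in>chains_of_type {1..n} r a. \<exists>xs\<in>Q. D \<subseteq> prefix_sets xs) \<and>
           real (card Q) \<le> M n r * (real r * ln (2 * w + 1) + 1) + 1"
proof -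
  let ?P = "permutations_of_set {1..n}" and ?W = "central_vectors n r w"
  define X where "X = (\<Union>a\<in>?W. chains_of_type {1..n} r a)"
  have W: "?W \<subseteq> index_vectors n r" by (auto simp: central_vectors_def)
  then have finW: "finite ?W" using finite_index_vectors finite_subset by blast
  have "\<exists>Q\<subseteq>?P. (\<forall>D\<in>X. \<exists>xs\<in>Q. D \<subseteq> prefix_sets xs) \<and>
          real (card Q) \<le> M n r * (ln ((2 * w + 1) ^ r) + 1) + 1"
  proof (rule greedy_cover)
    show "finite X" using finW by (auto simp: X_def finite_chains_of_type)
    show "M n r \<ge> 1" using M_ge_1 r by simp
    show "(2 * w + 1) ^ r \<ge> 1" using w by (intro one_le_power) simp
  next
    fix D assume "D \<in> X"
    then obtain a where a: "a \<in> ?W" "D \<in> chains_of_type {1..n} r a" by (auto simp: X_def)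
    let ?p = "\<Prod>i=0..r. fact (a i) :: nat" and ?c = "card {xs\<in>?P. D \<subseteq> prefix_sets xs}"
    have "fact n = multinomial n r a * real ?p"
      by (simp add: multinomial_def)
    also have "\<dots> \<le> M n r * real ?c"
    proof (rule mult_mono)
      show "multinomial n r a \<le> M n r" using multinomial_le_M a W by blast
      show "real ?p \<le> real ?c" unfolding of_nat_le_iff by (rule card_flags_through_chain_ge[OF _ a(2)]) simp
      show "0 \<le> M n r" using M_ge_1[OF r] by simp
    qed (rule of_nat_0_le_iff)
    finally show "real (card ?P) \<le> M n r * real ?c" by simp
  next
    fix xs assume xs: "xs \<in> ?P"
    have "{D\<in>X. D \<subseteq> prefix_sets xs} \<subseteq> (\<lambda>a. (\<lambda>i. set (take (\<Sum>j<i. a j) xs)) ` {1..r}) ` ?W"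
    proof clarify
      fix D assume "D \<in> X" "D \<subseteq> prefix_sets xs"
      then obtain a where a: "a \<in> ?W" "D \<in> chains_of_type {1..n} r a" by (auto simp: X_def)
      show "D \<in> (\<lambda>a. (\<lambda>i. set (take (\<Sum>j<i. a j) xs)) ` {1..r}) ` ?W"
        by (rule image_eqI[where x = a], rule chain_of_type_in_flag)
          (use a xs \<open>D \<subseteq> prefix_sets xs\<close> in simp_all)
    qed
    then have "card {D\<in>X. D \<subseteq> prefix_sets xs} \<le> card ?W"
      using finW by (rule surj_card_le[rotated])
    then show "real (card {D\<in>X. D \<subseteq> prefix_sets xs}) \<le> (2 * w + 1) ^ r"
      using card_central_vectors_le[OF w, of n r] by linarith
  qed simp_all
  then show ?thesis using w by (simp add: X_def ln_realpow)
qed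

text \<open>There are only polynomially many types, and each peripheral (non-central) one has few chains by
  \<open>multinomial_decay\<close>.\<close>
lemma card_peripheral_chains_le:
  assumes w: "w \<ge> 4" and M: "M n r \<ge> 0"
  shows "real (card (\<Union>a\<in>index_vectors n r - central_vectors n r w. chains_of_type {1..n} r a))
           \<le> (real n + 1) ^ (r + 1) * exp (- (w\<^sup>2 / (32 * real n))) * M n r"
proof -
  let ?V = "index_vectors n r - central_vectors n r w"
  let ?e = "exp (- (w\<^sup>2 / (32 * real n)))"
  have fin: "finite ?V" using finite_index_vectors by blast
  have "real (card (\<Union>a\<in>?V. chains_of_type {1..n} r a)) \<le> (\<Sum>a\<in>?V. real (card (chains_of_type {1..n} r a)))"
    using card_UN_le[OF fin, of "chains_of_type {1..n} r"] by (metis of_nat_le_iff of_nat_sum)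
  also have "\<dots> \<le> (\<Sum>a\<in>?V. ?e * M n r)"
  proof (rule sum_mono)
    fix a assume "a \<in> ?V"
    then obtain i where "a \<in> index_vectors n r" "i \<le> r" "\<bar>real (a i) - real n / (real r + 1)\<bar> > w"
      by (auto simp: central_vectors_def not_le)
    then have "exp (w\<^sup>2 / (32 * real n)) * multinomial n r a \<le> M n r"
      using w by (intro multinomial_decay)
    then have "multinomial n r a \<le> ?e * M n r"
      by (simp add: exp_minus field_simps)
    then show "real (card (chains_of_type {1..n} r a)) \<le> ?e * M n r"
      using card_chains_of_type_le_multinomial[of n r a] by linarith
  qed
  also have "\<dots> = real (card ?V) * (?e * M n r)" by simp
  also have "\<dots> \<le> (real n + 1) ^ (r + 1) * (?e * M n r)"
  proof (rule mult_right_mono)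
    have "card ?V \<le> (n + 1) ^ (r + 1)"
      using card_mono[OF finite_index_vectors, of ?V n r] card_index_vectors_le[of n r] by simp
    then have "real (card ?V) \<le> real ((n + 1) ^ (r + 1))" by (simp only: of_nat_le_iff)
    then show "real (card ?V) \<le> (real n + 1) ^ (r + 1)" by (simp add: algebra_simps)
  qed (use M in simp)
  finally show ?thesis by (simp only: mult.assoc)
qed

text \<open>Central chains are covered by flags from the greedy selection, and every peripheral chain by
  itself.\<close>
lemma N_upper_bound:
  assumes r: "r \<ge> 1" "r \<le> n" and w: "w \<ge> 4"
  shows "real (N n r) \<le> M n r * (real r * ln (2 * w + 1) + 1) + 1
           + (real n + 1) ^ (r + 1) * exp (- (w\<^sup>2 / (32 * real n))) * M n r"
proof -
  let ?V = "index_vectors n r - central_vectors n r w"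
  define Y where "Y = (\<Union>a\<in>?V. chains_of_type {1..n} r a)"
  have "w \<ge> 0" using w by simp
  from flags_cover_central_chains[OF r this] obtain Q where Q: "Q \<subseteq> permutations_of_set {1..n}"
    "\<forall>a\<in>central_vectors n r w. \<forall>D\<in>chains_of_type {1..n} r a. \<exists>xs\<in>Q. D \<subseteq> prefix_sets xs"
    "real (card Q) \<le> M n r * (real r * ln (2 * w + 1) + 1) + 1"
    by (elim exE conjE)
  have finQ: "finite Q" using finite_subset[OF Q(1)] by simp
  have finY: "finite Y"
    using finite_index_vectors by (auto simp: Y_def finite_chains_of_type)
  define \<C> where "\<C> = prefix_sets ` Q \<union> {D\<in>Y. is_chain n D}"
  have "covering_family n r \<C>"
    unfolding covering_family_def
  proof (intro conjI ballI allI impI)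
    fix C assume "C \<in> \<C>"
    then show "is_chain n C" using Q(1) prefix_sets_is_chain by (auto simp: \<C>_def)
  next
    fix D assume D: "is_chain n D \<and> card D = r"
    then have "\<exists>a\<in>index_vectors n r. D \<in> chains_of_type {1..n} r a"
      using chain_has_type[OF r(1)] by simp
    then obtain a where a: "a \<in> index_vectors n r" "D \<in> chains_of_type {1..n} r a" ..
    show "\<exists>C\<in>\<C>. covers C D"
    proof (cases "a \<in> central_vectors n r w")
      case True
      then obtain xs where "xs \<in> Q" "D \<subseteq> prefix_sets xs" using Q(2) a(2) by meson
      then show ?thesis unfolding \<C>_def covers_def by blast
    next
      case False
      then have "D \<in> \<C>" using a D unfolding \<C>_def Y_def by blast
      then show ?thesis unfolding covers_def by blast
    qed
  qed
  then have "N n r \<le> card \<C>" by (rule N_le)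
  also have "\<dots> \<le> card Q + card Y"
    unfolding \<C>_def using finQ finY
    by (intro order_trans[OF card_Un_le] add_mono card_image_le card_mono) auto
  finally have "real (N n r) \<le> real (card Q) + real (card Y)" by linarith
  moreover have "real (card Y) \<le> (real n + 1) ^ (r + 1) * exp (- (w\<^sup>2 / (32 * real n))) * M n r"
    unfolding Y_def using w M_ge_1[OF r] by (intro card_peripheral_chains_le) auto
  ultimately show ?thesis using Q(3) by linarith
qed

text \<open>With \<open>w = sqrt n * ln n\<close>, a single flag contains at most
  \<open>(2 * w + 1) ^ r = n ^ (r / 2 + o(1))\<close> central chains, and the logarithm of this number
  gives the constant \<open>r / 2\<close>, while there are at most \<open>M n r\<close> peripheral chains for large \<open>n\<close> since \<open>exp (- (ln n)\<^sup>2 / 32)\<close> beats every power of \<open>n\<close>.\<close>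
theorem theorem1p4:
  fixes r :: nat and \<epsilon> :: real
  assumes "r \<ge> 1" and "\<epsilon> > 0"
  shows "\<exists>n\<^sub>0. \<forall>n\<ge>n\<^sub>0.
           real (N n r) \<le> (real r / 2 + \<epsilon>) * ln (real n) * M n r"
proof -
  define \<delta> where "\<delta> = \<epsilon> / (2 * real r)"
  have \<delta>: "\<delta> > 0" "real r * \<delta> = \<epsilon> / 2" using assms by (auto simp: \<delta>_def)
  define w where "w = (\<lambda>n::nat. sqrt (real n) * ln (real n))"
  have "((\<lambda>n. ln (2 * w n + 1) / ln (real n)) \<longlongrightarrow> 1 / 2) at_top"
    unfolding w_def by real_asymp
  then have ev_ln: "eventually (\<lambda>n. ln (2 * w n + 1) / ln (real n) < 1 / 2 + \<delta>) at_top"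
    using \<delta> by (intro order_tendstoD) auto
  \<comment> \<open>The exponent \<open>(w n)\<^sup>2 / (32 * n)\<close> equals \<open>(ln n)\<^sup>2 / 32\<close> and must dominate \<open>(r + 1) * ln (n + 1)\<close>.\<close>
  have "filterlim (\<lambda>n. (ln (real n))\<^sup>2 / (32 * ln (real n + 1))) at_top at_top"
    by real_asymp
  then have ev_tail: "eventually (\<lambda>n. real r + 1 \<le> (ln (real n))\<^sup>2 / (32 * ln (real n + 1))) at_top"
    by (simp add: filterlim_at_top)
  have "filterlim w at_top at_top" unfolding w_def by real_asymp
  then have ev_w: "eventually (\<lambda>n. 4 \<le> w n) at_top"
    by (simp add: filterlim_at_top)
  have "filterlim (\<lambda>n::nat. ln (real n)) at_top at_top" by real_asymp
  \<comment> \<open>The three error terms of \<open>N_upper_bound\<close> add up to at most \<open>3 * M n r\<close>, absorbed by \<open>\<epsilon> / 2 * ln n\<close>.\<close>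
  then have ev_3: "eventually (\<lambda>n. 6 / \<epsilon> \<le> ln (real n)) at_top"
    by (simp add: filterlim_at_top)
  have "eventually (\<lambda>n. real (N n r) \<le> (real r / 2 + \<epsilon>) * ln (real n) * M n r) at_top"
    using ev_ln ev_tail ev_w ev_3 eventually_ge_at_top[of "max r 2"]
  proof eventually_elim
    case (elim n)
    have n: "n \<ge> 2" "r \<le> n" using elim by auto
    have ln: "ln (real n) > 0" "ln (real n + 1) > 0" using n by auto
    have M: "M n r \<ge> 1" using M_ge_1 assms n by simp
    have "(real n + 1) ^ (r + 1) = exp (real (r + 1) * ln (real n + 1))"
      unfolding exp_of_nat_mult by (simp add: add_pos_nonneg)
    also have "\<dots> \<le> exp ((w n)\<^sup>2 / (32 * real n))"
      using elim(2) n ln by (simp add: w_def power_mult_distrib field_simps)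
    finally have tail: "(real n + 1) ^ (r + 1) * exp (- ((w n)\<^sup>2 / (32 * real n))) \<le> 1"
      by (simp add: exp_minus field_simps)
    have "real r * ln (2 * w n + 1) \<le> real r * ((1 / 2 + \<delta>) * ln (real n))"
      using elim(1) ln by (intro mult_left_mono) (auto simp: field_simps)
    also have "\<dots> = (real r / 2 + \<epsilon> / 2) * ln (real n)"
      by (simp add: \<delta>(2)[symmetric] algebra_simps)
    finally have main: "real r * ln (2 * w n + 1) \<le> (real r / 2 + \<epsilon> / 2) * ln (real n)" .
    have three: "3 \<le> \<epsilon> / 2 * ln (real n)"
      using elim(4) assms by (simp add: field_simps)
    have "real (N n r) \<le> M n r * (real r * ln (2 * w n + 1) + 1) + 1
           + (real n + 1) ^ (r + 1) * exp (- ((w n)\<^sup>2 / (32 * real n))) * M n r"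
      using N_upper_bound assms n elim(3) by blast
    also have "\<dots> \<le> M n r * (real r * ln (2 * w n + 1) + 1) + M n r + 1 * M n r"
      using M mult_right_mono[OF tail, of "M n r"] by linarith
    also have "\<dots> = (real r * ln (2 * w n + 1) + 3) * M n r" by (simp add: algebra_simps)
    also have "\<dots> \<le> ((real r / 2 + \<epsilon> / 2) * ln (real n) + \<epsilon> / 2 * ln (real n)) * M n r"
      using main three M by (intro mult_right_mono) auto
    also have "\<dots> = (real r / 2 + \<epsilon>) * ln (real n) * M n r" by (simp add: algebra_simps)
    finally show ?case .
  qed
  then show ?thesis by (simp add: eventually_at_top_linorder)
qed

end
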